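(* Let $(V,\mathcal{V})$ be a simple majority voting system with $N$ voters, and let $v\in V$. Then 1. $$D_B(v)\approx\frac{2}{\sqrt{2\pi}}\cdot\frac{1}{\sqrt N}\quad\text{as } N\to\infty\qquad\text{and}\qquad E_B\approx\frac12\quad\text{as } N\to\infty .$$ 2. $$D_S(v)=\frac1N\quad\text{for all } N\qquad\text{and}\qquad E_S\approx\frac12\quad\text{as } N\to\infty .$$
   Context: The simple majority voting system with $N$ voters consists of a set $V$ with $|V|=N$ and the family $\mathcal{V}$ of winning coalitions, where a coalition $A\subset V$ is winning ($A\in\mathcal{V}$) if and only if it contains more than half of the voters, $|A|>N/2$ (equivalently: all weights equal $1$ and relative quota $r=\frac12+\frac1{2N}$, i.e. $|A|\ge rN$). For $v\in V$ let $\mathcal{D}^+(v)=\{A\subset V\mid v\notin A, A\notin\mathcal{V}, A\cup\{v\}\in\mathcal{V}\}$, $\mathcal{D}^-(v)=\{A\subset V\mid v\in A, A\in\mathcal{V}, A\setminus\{v\}\notin\mathcal{V}\}$, and $\mathcal{D}(v)=\mathcal{D}^+(v)\cup\mathcal{D}^-(v)$. The Penrose-Banzhaf measure on the power set $\mathcal{P}(V)$ is $\mathbb{P}_B(\mathcal{A})=|\mathcal{A}|/2^N$ for $\mathcal{A}\subset\mathcal{P}(V)$. The Shapley-Shubik measure $\mathbb{P}_S$ is the probability measure on $\mathcal{P}(V)$ giving each coalition $A$ with $|A|=k$ the probability $\mathbb{P}_S(A)=\frac{1}{N+1}\frac{1}{\binom Nk}$. Put $D_B(v)=\mathbb{P}_B(\mathcal{D}(v))$,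 $D_S(v)=\mathbb{P}_S(\mathcal{D}(v))$ (decisiveness) and $E_B=\mathbb{P}_B(\mathcal{V})$, $E_S=\mathbb{P}_S(\mathcal{V})$ (efficiency). $a_N\approx b_N$ as $N\to\infty$ means $a_N/b_N\to1$ as $N\to\infty$. *)

theory Defs
  imports "HOL-Library.Landau_Symbols"
begin

text \<open>
  A voting system is a finite set \<open>V\<close> of voters together with the family \<open>W\<close> of its winning
  coalitions, which are subsets of \<open>V\<close>.
\<close>

definition simple_majority :: "'a set \<Rightarrow> 'a set set" where
  "simple_majority V = {A. A \<subseteq> V \<and> real (card A) > real (card V) / 2}"

definition decisive_plus :: "'a set \<Rightarrow> 'a set set \<Rightarrow> 'a \<Rightarrow> 'a set set" where
  "decisive_plus V W v = {A. A \<subseteq> V \<and> v \<notin> A \<and> A \<notin> W \<and> A \<union> {v} \<in> W}"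

definition decisive_minus :: "'a set \<Rightarrow> 'a set set \<Rightarrow> 'a \<Rightarrow> 'a set set" where
  "decisive_minus V W v = {A. A \<subseteq> V \<and> v \<in> A \<and> A \<in> W \<and> A - {v} \<notin> W}"

definition decisive :: "'a set \<Rightarrow> 'a set set \<Rightarrow> 'a \<Rightarrow> 'a set set" where
  "decisive V W v = decisive_plus V W v \<union> decisive_minus V W v"

text \<open>
  Both measures live on the finite space \<open>Pow V\<close>, with every set of coalitions measurable; they are
  given as real-valued functions of \<open>\<A> \<subseteq> Pow V\<close>.
\<close>

definition penrose_banzhaf :: "'a set \<Rightarrow> 'a set set \<Rightarrow> real" where
  "penrose_banzhaf V \<A> = real (card \<A>) / 2 ^ card V"

definition shapley_shubik :: "'a set \<Rightarrow> 'a set set \<Rightarrow> real" where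
  "shapley_shubik V \<A> =
     (\<Sum>A\<in>\<A>. 1 / (real (card V) + 1) * (1 / real (card V choose card A)))"

lemma penrose_banzhaf_total:
  assumes "finite V"
  shows "penrose_banzhaf V (Pow V) = 1"
  using assms by (simp add: penrose_banzhaf_def card_Pow)

lemma shapley_shubik_total:
  assumes "finite V"
  shows "shapley_shubik V (Pow V) = 1"
proof -
  let ?n = "card V"
  let ?p = "\<lambda>A. 1 / (real ?n + 1) * (1 / real (?n choose card A))"
  have fin: "finite (Pow V)" using assms by simp
  have img: "card ` Pow V \<subseteq> {..?n}" using assms by (auto intro: card_mono)
  have "shapley_shubik V (Pow V) = (\<Sum>k\<le>?n. \<Sum>A | A \<in> Pow V \<and> card A = k. ?p A)"
    unfolding shapley_shubik_def by (rule sum.group[OF fin _ img, symmetric]) simp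
  also have "\<dots> = (\<Sum>k\<le>?n. 1 / (real ?n + 1))"
  proof (rule sum.cong[OF refl])
    fix k assume "k \<in> {..?n}"
    then have nz: "?n choose k \<noteq> 0" by simp
    have "(\<Sum>A | A \<in> Pow V \<and> card A = k. ?p A)
        = (\<Sum>A | A \<in> Pow V \<and> card A = k. 1 / (real ?n + 1) * (1 / real (?n choose k)))"
      by (rule sum.cong) auto
    also have "\<dots> = real (?n choose k) * (1 / (real ?n + 1) * (1 / real (?n choose k)))"
      using n_subsets[OF assms, of k] by simp
    also have "\<dots> = 1 / (real ?n + 1)" using nz by simp
    finally show "(\<Sum>A | A \<in> Pow V \<and> card A = k. ?p A) = 1 / (real ?n + 1)" .
  qed
  also have "\<dots> = 1" by (simp add: field_simps)
  finally show ?thesis .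
qed

definition D_B :: "'a set \<Rightarrow> 'a set set \<Rightarrow> 'a \<Rightarrow> real" where
  "D_B V W v = penrose_banzhaf V (decisive V W v)"

definition D_S :: "'a set \<Rightarrow> 'a set set \<Rightarrow> 'a \<Rightarrow> real" where
  "D_S V W v = shapley_shubik V (decisive V W v)"

definition E_B :: "'a set \<Rightarrow> 'a set set \<Rightarrow> real" where
  "E_B V W = penrose_banzhaf V W"

definition E_S :: "'a set \<Rightarrow> 'a set set \<Rightarrow> real" where
  "E_S V W = shapley_shubik V W"

end

theory Submission
  imports Defs "HOL-Analysis.Gamma_Function" "HOL-Real_Asymp.Real_Asymp"
begin

text \<open>
  With \<open>N\<close> voters and \<open>m = N div 2\<close>, a voter \<open>v\<close> is decisive for a coalition exactly when the other
  members of the coalition number \<open>m\<close>, whether \<open>N\<close> is even or odd. The \<open>N - 1\<close> voters other than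
  \<open>v\<close> have \<open>N - 1 choose m\<close> subsets of that size, and each of them yields one decisive coalition
  without \<open>v\<close>, of size \<open>m\<close>, and one with \<open>v\<close>, of size \<open>m + 1\<close>
  (\<open>sum_decisive_simple_majority\<close>). For the Shapley-Shubik weights the resulting quotients of
  neighbouring binomial coefficients add up to exactly \<open>1 / N\<close>. For the Penrose-Banzhaf weights the
  result is \<open>(2 * m choose m) / 4 ^ m\<close> for either parity of \<open>N\<close>, and this is asymptotically
  \<open>1 / sqrt (pi * m)\<close>, because the partial Wallis products are the reciprocals of
  \<open>(2 * n + 1) * ((2 * n choose n) / 4 ^ n) ^ 2\<close>.

  Both measures depend only on the size of a coalition and are invariant under complementation,
  which exchanges winning coalitions with those having less than half of the voters. Hence twice the
  efficiency and the probability of a tie add up to 1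
  (\<open>sum_Pow_eq_simple_majority_ties\<close>). The probability of a tie is at most
  \<open>(2 * m choose m) / 4 ^ m\<close> for the first measure and at most \<open>1 / (N + 1)\<close> for the second, so it
  vanishes in the limit.
\<close>

section \<open>Central binomial coefficients\<close>

text \<open>The probability that \<open>2 * m\<close> tosses of a fair coin show equally many heads and tails.\<close>

definition central_binomial_mass :: "nat \<Rightarrow> real" where
  "central_binomial_mass m = real (2 * m choose m) / 4 ^ m"

lemma central_binomial_mass_pos: "central_binomial_mass m > 0"
  by (simp add: central_binomial_mass_def)

lemma central_binomial_Suc:
  "(real m + 1) * real (2 * Suc m choose Suc m) = 2 * (2 * real m + 1) * real (2 * m choose m)"
proof -
  have 1: "Suc m * (2 * Suc m choose Suc m) = 2 * Suc m * (Suc (2 * m) choose m)"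
    using Suc_times_binomial[of m "Suc (2 * m)"] by simp
  have 2: "Suc m * (Suc (2 * m) choose m) = (2 * m + 1) * (2 * m choose m)"
    using Suc_times_binomial_add[of m m] Suc_times_binomial[of m "2 * m"]
      binomial_symmetric[of m "Suc (2 * m)"] by simp
  have "Suc m * (2 * Suc m choose Suc m) = 2 * (2 * m + 1) * (2 * m choose m)"
    using 1 2 by (metis mult.assoc)
  from arg_cong[OF this, of real] show ?thesis by (simp add: algebra_simps)
qed

lemma central_binomial_mass_Suc:
  "central_binomial_mass (Suc m) = (2 * real m + 1) / (2 * real m + 2) * central_binomial_mass m"
proof -
  have "real (2 * Suc m choose Suc m) * (2 * real m + 2) = (2 * real m + 1) * real (2 * m choose m) * 4"
    using central_binomial_Suc[of m] by algebra
  thus ?thesis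
    unfolding central_binomial_mass_def by (simp add: divide_simps del: binomial_Suc_Suc)
qed

text \<open>
  Up to a factor linear in \<open>n\<close>, the Wallis product is an inverse square of central binomial masses,
  since \<open>(2 * k)\<^sup>2 / ((2 * k - 1) * (2 * k + 1))\<close> is \<open>(2 * k - 1) / (2 * k + 1)\<close> times the square of
  \<open>2 * k / (2 * k - 1)\<close>, the ratio of the mass at \<open>k - 1\<close> to that at \<open>k\<close>. So Wallis' limit \<open>pi / 2\<close>
  gives the asymptotics of the masses.
\<close>

lemma wallis_product_eq_central_binomial_mass:
  "(\<Prod>k=1..n. (4 * real k ^ 2) / (4 * real k ^ 2 - 1)) =
     1 / ((2 * real n + 1) * central_binomial_mass n ^ 2)"
proof (induction n)
  case 0
  show ?case by (simp add: central_binomial_mass_def)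
next
  case (Suc n)
  have factor: "(4 * real (Suc n) ^ 2) / (4 * real (Suc n) ^ 2 - 1) =
      (2 * real n + 2) ^ 2 / ((2 * real n + 1) * (2 * real n + 3))"
    by (rule arg_cong2[where f = "(/)"]) (simp_all add: power2_eq_square algebra_simps)
  have "(\<Prod>k=1..Suc n. (4 * real k ^ 2) / (4 * real k ^ 2 - 1)) =
    (2 * real n + 2) ^ 2 / ((2 * real n + 1) * (2 * real n + 3)) *
    (1 / ((2 * real n + 1) * central_binomial_mass n ^ 2))"
    using Suc factor by (simp add: prod.cl_ivl_Suc del: of_nat_Suc)
  also have "\<dots> = 1 / ((2 * real (Suc n) + 1) * central_binomial_mass (Suc n) ^ 2)"
    unfolding central_binomial_mass_Suc
    by (simp add: power_mult_distrib power_divide power2_eq_square ac_simps)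
  finally show ?case .
qed

lemma central_binomial_mass_asymp_equiv:
  "central_binomial_mass \<sim>[sequentially] (\<lambda>m. 1 / sqrt (pi * real m))"
proof (rule asymp_equivI')
  have "(\<lambda>n. 1 / ((2 * real n + 1) * central_binomial_mass n ^ 2)) \<longlonglongrightarrow> pi / 2"
    using wallis unfolding wallis_product_eq_central_binomial_mass .
  hence "(\<lambda>n. inverse (1 / ((2 * real n + 1) * central_binomial_mass n ^ 2))) \<longlonglongrightarrow> inverse (pi / 2)"
    by (intro tendsto_inverse) auto
  hence 1: "(\<lambda>n. (2 * real n + 1) * central_binomial_mass n ^ 2) \<longlonglongrightarrow> 2 / pi"
    by simp
  have 2: "(\<lambda>n. real n / (2 * real n + 1)) \<longlonglongrightarrow> 1 / 2"
    by real_asymp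
  have "(\<lambda>n. sqrt (pi * (real n / (2 * real n + 1) * ((2 * real n + 1) * central_binomial_mass n ^ 2))))
      \<longlonglongrightarrow> sqrt (pi * (1 / 2 * (2 / pi)))"
    by (intro tendsto_intros 1 2)
  moreover have "sqrt (pi * (real n / (2 * real n + 1) * ((2 * real n + 1) * central_binomial_mass n ^ 2)))
      = central_binomial_mass n / (1 / sqrt (pi * real n))" for n
  proof -
    have "pi * (real n / (2 * real n + 1) * ((2 * real n + 1) * central_binomial_mass n ^ 2))
        = pi * real n * central_binomial_mass n ^ 2"
      by (simp add: add_nonneg_eq_0_iff)
    thus ?thesis using central_binomial_mass_pos[of n] by (simp add: real_sqrt_mult)
  qed
  ultimately show "(\<lambda>n. central_binomial_mass n / (1 / sqrt (pi * real n))) \<longlonglongrightarrow> 1"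
    by simp
qed

lemma filterlim_div_2: "filterlim (\<lambda>N::nat. N div 2) sequentially sequentially"
  unfolding filterlim_at_top
proof
  fix Z :: nat
  show "\<forall>\<^sub>F N in sequentially. Z \<le> N div 2"
    using eventually_ge_at_top[of "2 * Z"] by eventually_elim auto
qed

lemma central_binomial_mass_div_2_asymp_equiv:
  "(\<lambda>N. central_binomial_mass (N div 2)) \<sim>[sequentially]
     (\<lambda>N. 2 / sqrt (2 * pi) * (1 / sqrt (real N)))"
proof -
  have "(\<lambda>N. central_binomial_mass (N div 2)) \<sim>[sequentially] (\<lambda>N. 1 / sqrt (pi * real (N div 2)))"
    by (rule asymp_equiv_compose'[OF central_binomial_mass_asymp_equiv filterlim_div_2])
  also have "(\<lambda>N. 1 / sqrt (pi * real (N div 2))) \<sim>[sequentially]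
      (\<lambda>N. 2 / sqrt (2 * pi) * (1 / sqrt (real N)))"
  proof (rule asymp_equivI')
    \<comment> \<open>Rounding changes \<open>N / 2\<close> by less than 1, so it is lost in the limit of the quotient.\<close>
    have h: "real (N div 2) = of_int \<lfloor>real N / 2\<rfloor>" for N
      using floor_divide_of_nat_eq[of N 2, where ?'a = real] by simp
    have "(\<lambda>N. (real N / 2) / real (N div 2)) \<longlonglongrightarrow> 1"
      unfolding h by real_asymp
    hence "(\<lambda>N. sqrt ((real N / 2) / real (N div 2))) \<longlonglongrightarrow> sqrt 1"
      by (rule tendsto_real_sqrt)
    moreover have "sqrt ((real N / 2) / real (N div 2)) =
        1 / sqrt (pi * real (N div 2)) / (2 / sqrt (2 * pi) * (1 / sqrt (real N)))" for N
    proof -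
      have "2 / sqrt (2 * pi) = sqrt 2 / sqrt pi" by (simp add: real_sqrt_mult field_simps)
      thus ?thesis by (simp add: real_sqrt_mult real_sqrt_divide)
    qed
    ultimately show "(\<lambda>N. 1 / sqrt (pi * real (N div 2)) / (2 / sqrt (2 * pi) * (1 / sqrt (real N)))) \<longlonglongrightarrow> 1"
      by simp
  qed
  finally show ?thesis .
qed

lemma central_binomial_mass_div_2_tendsto_0:
  "(\<lambda>N. central_binomial_mass (N div 2)) \<longlonglongrightarrow> 0"
proof -
  have "(\<lambda>N. 2 / sqrt (2 * pi) * (1 / sqrt (real N))) \<longlonglongrightarrow> 0" by real_asymp
  thus ?thesis
    using central_binomial_mass_div_2_asymp_equiv asymp_equiv_sym tendsto_asymp_equiv_cong by blast
qed

section \<open>Decisiveness\<close>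

lemma simple_majority_iff: "A \<in> simple_majority V \<longleftrightarrow> A \<subseteq> V \<and> card V < 2 * card A"
proof -
  have "real (card V) / 2 < real (card A) \<longleftrightarrow> card V < 2 * card A" by linarith
  thus ?thesis by (simp add: simple_majority_def)
qed

text \<open>
  A coalition of \<open>k\<close> voters loses and gains the majority by one more voter iff
  \<open>2 * k \<le> N < 2 * k + 2\<close>, and rounding down makes \<open>k = N div 2\<close> the solution for both parities of
  \<open>N\<close>.
\<close>

lemma decisive_plus_simple_majority:
  assumes "finite V" "v \<in> V"
  shows "decisive_plus V (simple_majority V) v = {A. A \<subseteq> V - {v} \<and> card A = card V div 2}"
proof -
  have "A \<notin> simple_majority V \<and> A \<union> {v} \<in> simple_majority V \<longleftrightarrow> card A = card V div 2"
    if "A \<subseteq> V" "v \<notin> A" for A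
  proof -
    have "card (insert v A) = Suc (card A)"
      using that assms finite_subset by (metis card_insert_disjoint)
    thus ?thesis using that assms by (simp add: simple_majority_iff) linarith
  qed
  thus ?thesis by (auto simp: decisive_plus_def)
qed

lemma decisive_minus_eq_insert_decisive_plus:
  assumes "v \<in> V"
  shows "decisive_minus V W v = insert v ` decisive_plus V W v"
proof (intro equalityI subsetI)
  fix A assume A: "A \<in> decisive_minus V W v"
  hence "A = insert v (A - {v})" "A - {v} \<in> decisive_plus V W v"
    by (auto simp: decisive_minus_def decisive_plus_def insert_absorb)
  thus "A \<in> insert v ` decisive_plus V W v" by blast
next
  fix A assume "A \<in> insert v ` decisive_plus V W v"
  thus "A \<in> decisive_minus V W v"
    using assms by (auto simp: decisive_minus_def decisive_plus_def)
qed

text \<open>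
  Both measures weight a coalition by a function of its size, so this single count serves for both.
\<close>

lemma sum_decisive_simple_majority:
  fixes f :: "nat \<Rightarrow> real"
  assumes "finite V" "v \<in> V"
  shows "(\<Sum>A\<in>decisive V (simple_majority V) v. f (card A)) =
    real (card V - 1 choose (card V div 2)) * (f (card V div 2) + f (Suc (card V div 2)))"
proof -
  let ?P = "decisive_plus V (simple_majority V) v"
  let ?M = "decisive_minus V (simple_majority V) v"
  have P: "?P = {A. A \<subseteq> V - {v} \<and> card A = card V div 2}"
    by (rule decisive_plus_simple_majority[OF assms])
  have M: "?M = insert v ` ?P"
    by (rule decisive_minus_eq_insert_decisive_plus[OF assms(2)])
  have fin: "finite ?P" using assms P by simp
  have disj: "?P \<inter> ?M = {}" by (auto simp: decisive_plus_def decisive_minus_def)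
  have inj: "inj_on (insert v) ?P"
    by (rule inj_onI) (auto simp: P dest: insert_ident[THEN iffD1, rotated 2])
  have cP: "card ?P = (card V - 1 choose (card V div 2))"
    using n_subsets[of "V - {v}" "card V div 2"] assms by (simp add: P)
  have "(\<Sum>A\<in>decisive V (simple_majority V) v. f (card A)) =
      (\<Sum>A\<in>?P. f (card A)) + (\<Sum>A\<in>?P. f (card (insert v A)))"
    using fin disj inj by (simp add: decisive_def sum.union_disjoint M sum.reindex)
  also have "(\<Sum>A\<in>?P. f (card A)) = (\<Sum>A\<in>?P. f (card V div 2))"
    by (rule sum.cong) (auto simp: P)
  also have "(\<Sum>A\<in>?P. f (card (insert v A))) = (\<Sum>A\<in>?P. f (Suc (card V div 2)))"
  proof (rule sum.cong)
    fix A assume A: "A \<in> ?P"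
    hence "finite A" "v \<notin> A" using assms P by (auto intro: finite_subset)
    thus "f (card (insert v A)) = f (Suc (card V div 2))" using A P by simp
  qed simp
  finally show ?thesis using cP by (simp add: algebra_simps)
qed

lemma penrose_banzhaf_eq_sum: "penrose_banzhaf V \<A> = (\<Sum>A\<in>\<A>. 1 / 2 ^ card V)"
  by (simp add: penrose_banzhaf_def)

text \<open>
  An odd \<open>N = 2 * m + 1\<close> leaves \<open>2 * m\<close> other voters, so the central binomial coefficient appears
  directly. For \<open>N = 2 * m\<close> it appears because \<open>2 * m - 1 choose m\<close> is half of it, by the symmetry
  in Pascal's rule.
\<close>

lemma D_B_simple_majority:
  assumes "finite V" "v \<in> V"
  shows "D_B V (simple_majority V) v = central_binomial_mass (card V div 2)"
proof -
  define m where "m = card V div 2"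
  have pos: "card V > 0" using assms by (auto simp: card_gt_0_iff)
  have D: "D_B V (simple_majority V) v = real (card V - 1 choose m) * (2 / 2 ^ card V)"
    using sum_decisive_simple_majority[OF assms, of "\<lambda>_. 1 / 2 ^ card V"]
    by (simp add: D_B_def penrose_banzhaf_eq_sum m_def)
  show ?thesis
  proof (cases "even (card V)")
    case True
    then obtain k where k: "m = Suc k" "card V = 2 * Suc k"
      using pos by (metis even_two_times_div_two m_def mult_0_right not0_implies_Suc not_less_zero)
    have "2 * (Suc (2 * k) choose Suc k) = (2 * Suc k choose Suc k)"
      using binomial_symmetric[of k "Suc (2 * k)"] by simp
    from arg_cong[OF this, of real]
    have "2 * real (Suc (2 * k) choose Suc k) = real (2 * Suc k choose Suc k)"
      by (simp del: binomial_Suc_Suc)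
    moreover have "D_B V (simple_majority V) v = 2 * real (Suc (2 * k) choose Suc k) / 2 ^ (2 * Suc k)"
      using D k by (simp del: binomial_Suc_Suc)
    ultimately have "D_B V (simple_majority V) v = real (2 * Suc k choose Suc k) / 2 ^ (2 * Suc k)"
      by metis
    also have "(2::real) ^ (2 * Suc k) = 4 ^ Suc k"
      unfolding power_mult by simp
    finally show ?thesis
      unfolding m_def[symmetric] k(1) central_binomial_mass_def .
  next
    case False
    hence "card V = Suc (2 * m)" by (simp add: m_def)
    thus ?thesis using D
      by (simp add: m_def[symmetric] central_binomial_mass_def power_mult)
  qed
qed

text \<open>
  With \<open>N = n + 1\<close>, the quotients of \<open>n choose m\<close> by \<open>N choose m\<close> and by \<open>N choose (m + 1)\<close> are
  \<open>(N - m) / N\<close> and \<open>(m + 1) / N\<close>. Their sum \<open>(N + 1) / N\<close> does not depend on \<open>m\<close>, and its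
  numerator cancels against the normalisation of the Shapley-Shubik measure.
\<close>

lemma D_S_simple_majority:
  assumes "finite V" "v \<in> V"
  shows "D_S V (simple_majority V) v = 1 / real (card V)"
proof -
  define m where "m = card V div 2"
  obtain n where n: "card V = Suc n"
    using assms by (metis card_gt_0_iff empty_iff gr0_implies_Suc)
  have mn: "m \<le> n" using n by (simp add: m_def)
  have "Suc m * (Suc n choose Suc m) = Suc n * (n choose m)"
    by (rule Suc_times_binomial)
  from arg_cong[OF this, of real]
  have up: "real (n choose m) / real (Suc n choose Suc m) = (real m + 1) / (real n + 1)"
    using mn by (simp add: field_simps del: binomial_Suc_Suc)
  have "(Suc n - m) * (Suc n choose m) = Suc n * (n choose m)"
    using binomial_absorb_comp[of "Suc n" m] by simp
  from arg_cong[OF this, of real]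
  have low: "real (n choose m) / real (Suc n choose m) = (real n + 1 - real m) / (real n + 1)"
    using mn by (simp add: field_simps of_nat_diff del: binomial_Suc_Suc)
  have "D_S V (simple_majority V) v = real (n choose m) *
      (1 / (real n + 2) * (1 / real (Suc n choose m)) + 1 / (real n + 2) * (1 / real (Suc n choose Suc m)))"
    using sum_decisive_simple_majority[OF assms,
        of "\<lambda>k. 1 / (real (card V) + 1) * (1 / real (card V choose k))"]
    by (simp add: D_S_def shapley_shubik_def n m_def[unfolded n, symmetric] add.commute
        del: binomial_Suc_Suc)
  also have "\<dots> = (real (n choose m) / real (Suc n choose m) +
      real (n choose m) / real (Suc n choose Suc m)) / (real n + 2)"
    by (simp add: add_divide_distrib distrib_left mult.commute del: binomial_Suc_Suc)
  also have "\<dots> = 1 / (real n + 1)"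
  proof -
    have "(real n + 1 - real m) / (real n + 1) + (real m + 1) / (real n + 1) =
        (real n + 2) / (real n + 1)"
      by (simp add: add_divide_distrib[symmetric])
    thus ?thesis unfolding up low by simp
  qed
  finally show ?thesis using n by (simp add: add.commute)
qed

section \<open>Efficiency\<close>

definition ties :: "'a set \<Rightarrow> 'a set set" where
  "ties V = {A. A \<subseteq> V \<and> 2 * card A = card V}"

text \<open>
  Complementation is a bijection between the majorities and the minorities, and by the assumed
  symmetry it preserves their weights. What remains of the power set are the ties.
\<close>

lemma sum_Pow_eq_simple_majority_ties:
  fixes f :: "nat \<Rightarrow> real"
  assumes "finite V" and sym: "\<And>k. k \<le> card V \<Longrightarrow> f (card V - k) = f k"
  shows "(\<Sum>A\<in>Pow V. f (card A)) =
    2 * (\<Sum>A\<in>simple_majority V. f (card A)) + (\<Sum>A\<in>ties V. f (card A))"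
proof -
  let ?W = "simple_majority V" and ?L = "{A. A \<subseteq> V \<and> 2 * card A < card V}"
  have fin: "finite ?W" "finite ?L" "finite (ties V)"
    by (rule finite_subset[of _ "Pow V"]; use assms(1) in \<open>auto simp: simple_majority_iff ties_def\<close>)+
  have cc: "card (V - A) = card V - card A" "card A \<le> card V" if "A \<subseteq> V" for A
    using that assms(1) by (auto simp: card_Diff_subset finite_subset card_mono)
  have "(\<Sum>A\<in>?L. f (card A)) = (\<Sum>A\<in>?W. f (card A))"
  proof (rule sum.reindex_bij_witness[where i = "\<lambda>A. V - A" and j = "\<lambda>A. V - A"])
    fix A assume "A \<in> ?L"
    thus "V - (V - A) = A" "V - A \<in> ?W" "f (card (V - A)) = f (card A)"
      using cc[of A] sym[of "card A"] by (auto simp: simple_majority_iff)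
  next
    fix A assume "A \<in> ?W"
    thus "V - (V - A) = A" "V - A \<in> ?L"
      using cc[of A] by (auto simp: simple_majority_iff)
  qed
  moreover have "Pow V = ?W \<union> ?L \<union> ties V"
    by (auto simp: simple_majority_iff ties_def)
  moreover have "?W \<inter> ?L = {}" "(?W \<union> ?L) \<inter> ties V = {}"
    by (auto simp: simple_majority_iff ties_def)
  ultimately show ?thesis using fin by (simp add: sum.union_disjoint)
qed

lemma card_ties:
  assumes "finite V"
  shows "card (ties V) = (if even (card V) then card V choose (card V div 2) else 0)"
proof (cases "even (card V)")
  case True
  hence "ties V = {A. A \<subseteq> V \<and> card A = card V div 2}" by (auto simp: ties_def)
  thus ?thesis using True n_subsets[OF assms] by simp
next
  case False
  hence "ties V = {}" unfolding ties_def by (metis (mono_tags, lifting) Collect_empty_eq dvd_triv_left)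
  thus ?thesis using False by simp
qed

lemma half_bounds:
  fixes e t b :: real
  assumes "1 = 2 * e + t" "0 \<le> t" "t \<le> b"
  shows "e \<in> {(1 - b) / 2 .. 1 / 2}"
  using assms by (simp add: field_simps)

text \<open>
  The lower bound is attained for an even number of voters, and the upper one for an odd number, where
  no ties occur. The same holds for the Shapley-Shubik measure below.
\<close>

lemma E_B_simple_majority_bounds:
  assumes "finite V"
  shows "E_B V (simple_majority V) \<in> {(1 - central_binomial_mass (card V div 2)) / 2 .. 1 / 2}"
proof -
  have "1 = 2 * E_B V (simple_majority V) + penrose_banzhaf V (ties V)"
    using sum_Pow_eq_simple_majority_ties[OF assms, of "\<lambda>_. 1 / 2 ^ card V"]
      penrose_banzhaf_total[OF assms]
    by (simp only: E_B_def penrose_banzhaf_eq_sum)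
  moreover have "0 \<le> penrose_banzhaf V (ties V)"
    by (simp add: penrose_banzhaf_def)
  moreover have "penrose_banzhaf V (ties V) \<le> central_binomial_mass (card V div 2)"
    using central_binomial_mass_pos[of "card V div 2"]
    by (auto simp: penrose_banzhaf_def card_ties[OF assms] central_binomial_mass_def power_mult
        elim!: evenE)
  ultimately show ?thesis by (rule half_bounds)
qed

lemma E_S_simple_majority_bounds:
  assumes "finite V"
  shows "E_S V (simple_majority V) \<in> {(1 - 1 / (real (card V) + 1)) / 2 .. 1 / 2}"
proof -
  let ?f = "\<lambda>k. 1 / (real (card V) + 1) * (1 / real (card V choose k))"
  have "?f (card V - k) = ?f k" if "k \<le> card V" for k
    using binomial_symmetric[OF that] by simp
  hence "1 = 2 * E_S V (simple_majority V) + shapley_shubik V (ties V)"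
    using sum_Pow_eq_simple_majority_ties[OF assms, of ?f] shapley_shubik_total[OF assms]
    by (simp only: E_S_def shapley_shubik_def)
  moreover have "0 \<le> shapley_shubik V (ties V)"
    unfolding shapley_shubik_def by (intro sum_nonneg) simp
  moreover have "shapley_shubik V (ties V) \<le> 1 / (real (card V) + 1)"
  proof -
    have "shapley_shubik V (ties V) = (\<Sum>A\<in>ties V. ?f (card V div 2))"
      unfolding shapley_shubik_def
    proof (rule sum.cong[OF refl])
      fix A assume "A \<in> ties V"
      hence "card A = card V div 2" unfolding ties_def mem_Collect_eq by linarith
      thus "?f (card A) = ?f (card V div 2)" by (rule arg_cong)
    qed
    also have "\<dots> \<le> 1 / (real (card V) + 1)"
      by (simp add: card_ties[OF assms])
    finally show ?thesis .
  qed
  ultimately show ?thesis by (rule half_bounds)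
qed

lemma asymp_equiv_half:
  fixes f t :: "nat \<Rightarrow> real"
  assumes bounds: "\<forall>\<^sub>F N in sequentially. f N \<in> {(1 - t N) / 2 .. 1 / 2}"
    and t: "t \<longlonglongrightarrow> 0"
  shows "f \<sim>[sequentially] (\<lambda>_. 1 / 2)"
proof (rule tendsto_imp_asymp_equiv_const)
  have "(\<lambda>N. (1 - t N) / 2) \<longlonglongrightarrow> (1 - 0) / 2"
    by (intro tendsto_intros t) simp
  hence lower: "(\<lambda>N. (1 - t N) / 2) \<longlonglongrightarrow> 1 / 2" by simp
  show "f \<longlonglongrightarrow> 1 / 2"
  proof (rule tendsto_sandwich[OF _ _ lower tendsto_const])
    show "\<forall>\<^sub>F N in sequentially. (1 - t N) / 2 \<le> f N"
      using bounds by eventually_elim simp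
    show "\<forall>\<^sub>F N in sequentially. f N \<le> 1 / 2"
      using bounds by eventually_elim simp
  qed
qed simp

theorem proposition4p1:
  fixes V :: "nat \<Rightarrow> 'a set" and v :: "nat \<Rightarrow> 'a"
  assumes "\<And>N. N \<ge> 1 \<Longrightarrow> finite (V N) \<and> card (V N) = N \<and> v N \<in> V N"
  shows "((\<lambda>N. D_B (V N) (simple_majority (V N)) (v N))
           \<sim>[sequentially] (\<lambda>N. 2 / sqrt (2 * pi) * (1 / sqrt (real N)))
         \<and> (\<lambda>N. E_B (V N) (simple_majority (V N))) \<sim>[sequentially] (\<lambda>_. 1 / 2))
       \<and> ((\<forall>N\<ge>1. D_S (V N) (simple_majority (V N)) (v N) = 1 / real N)
         \<and> (\<lambda>N. E_S (V N) (simple_majority (V N))) \<sim>[sequentially] (\<lambda>_. 1 / 2))"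
proof (intro conjI allI impI)
  have "D_B (V N) (simple_majority (V N)) (v N) = central_binomial_mass (N div 2)" if "N \<ge> 1" for N
    using assms[OF that] D_B_simple_majority by metis
  hence "\<forall>\<^sub>F N in sequentially.
      D_B (V N) (simple_majority (V N)) (v N) = central_binomial_mass (N div 2)"
    using eventually_sequentially by blast
  from asymp_equiv_refl_ev[OF this]
  show "(\<lambda>N. D_B (V N) (simple_majority (V N)) (v N))
      \<sim>[sequentially] (\<lambda>N. 2 / sqrt (2 * pi) * (1 / sqrt (real N)))"
    using central_binomial_mass_div_2_asymp_equiv by (rule asymp_equiv_trans)
next
  have "\<forall>\<^sub>F N in sequentially. E_B (V N) (simple_majority (V N)) \<in>
      {(1 - central_binomial_mass (N div 2)) / 2 .. 1 / 2}"
    using eventually_ge_at_top[of 1]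
    by eventually_elim (metis assms E_B_simple_majority_bounds)
  thus "(\<lambda>N. E_B (V N) (simple_majority (V N))) \<sim>[sequentially] (\<lambda>_. 1 / 2)"
    using central_binomial_mass_div_2_tendsto_0 by (rule asymp_equiv_half)
next
  fix N :: nat assume "N \<ge> 1"
  thus "D_S (V N) (simple_majority (V N)) (v N) = 1 / real N"
    using assms D_S_simple_majority by metis
next
  have "\<forall>\<^sub>F N in sequentially. E_S (V N) (simple_majority (V N)) \<in>
      {(1 - 1 / (real N + 1)) / 2 .. 1 / 2}"
    using eventually_ge_at_top[of 1]
    by eventually_elim (metis assms E_S_simple_majority_bounds)
  moreover have "(\<lambda>N. 1 / (real N + 1)) \<longlonglongrightarrow> 0"
    by real_asymp
  ultimately show "(\<lambda>N. E_S (V N) (simple_majority (V N))) \<sim>[sequentially] (\<lambda>_. 1 / 2)"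
    by (rule asymp_equiv_half)
qed

end
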